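(* Let $n,r\ge 1$ be integers and let $A,B_1,\dots,B_n,C_1,\dots,C_n$ be positive stable matrices in $\mathbb{C}^{r\times r}$ such that $\alpha(A)<1$ and $\alpha(B_i)<\beta(C_i)$ for $i=1,\dots,n$. Then the series $$F_{\mathcal{A}}[A,B_1,\dots,B_n;C_1,\dots,C_n;x_1,\dots,x_n]=\sum_{m_1,\dots,m_n=0}^{\infty}(A)_{m_1+\cdots+m_n}(B_1)_{m_1}\cdots(B_n)_{m_n}(C_1)_{m_1}^{-1}\cdots(C_n)_{m_n}^{-1}\,\frac{x_1^{m_1}\cdots x_n^{m_n}}{m_1!\cdots m_n!}$$ converges absolutely for all $x_1,\dots,x_n\in\mathbb{C}$ with $|x_1|+\cdots+|x_n|<1$.
   Context: For $M\in\mathbb{C}^{r\times r}$ with spectrum $\sigma(M)$, $\alpha(M)=\max\{\Re(z):z\in\sigma(M)\}$ and $\beta(M)=\min\{\Re(z):z\in\sigma(M)\}$; $M$ is positive stable if $\beta(M)>0$. The Pochhammer symbol is $(M)_0=I$ and $(M)_k=M(M+I)\cdots(M+(k-1)I)$ for $k\ge1$; $(M)_k^{-1}$ denotes the inverse matrix of $(M)_k$. Matrix products are taken in the written order (no commutativity is assumed). Absolute convergence means that the series of norms of the terms converges. *)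

theory Defs
  imports "HOL-Analysis.Analysis"
begin

definition mat_spectrum :: "complex ^ 'r ^ 'r \<Rightarrow> complex set" where
  "mat_spectrum M = {z. \<exists>v. v \<noteq> 0 \<and> M *v v = z *s v}"

(* The spectrum of a complex matrix is finite, and nonempty because index types are
   nonempty, so Max and Min below are the genuine maximum and minimum. *)

definition spec_alpha :: "complex ^ 'r ^ 'r \<Rightarrow> real" where
  "spec_alpha M = Max (Re ` mat_spectrum M)"

definition spec_beta :: "complex ^ 'r ^ 'r \<Rightarrow> real" where
  "spec_beta M = Min (Re ` mat_spectrum M)"

definition positive_stable :: "complex ^ 'r ^ 'r \<Rightarrow> bool" where
  "positive_stable M \<longleftrightarrow> spec_beta M > 0"

(* The library's pochhammer cannot be used: on complex ^ 'r ^ 'r the operation * is the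
   entrywise product and 1 is the all-ones matrix.  Note that mat c is c times the identity. *)

primrec mat_pochhammer :: "complex ^ 'r ^ 'r \<Rightarrow> nat \<Rightarrow> complex ^ 'r ^ 'r" where
  "mat_pochhammer M 0 = mat 1"
| "mat_pochhammer M (Suc k) = mat_pochhammer M k ** (M + mat (of_nat k))"

definition mat_prod_list :: "(complex ^ 'r ^ 'r) list \<Rightarrow> complex ^ 'r ^ 'r" where
  "mat_prod_list Ms = foldr (**) Ms (mat 1)"

definition mat_smult :: "complex \<Rightarrow> complex ^ 'r ^ 'r \<Rightarrow> complex ^ 'r ^ 'r" where
  "mat_smult c M = (\<chi> i j. c * M $ i $ j)"

(* Families are indexed by 1, ..., n; the lists over [1..<Suc n] fix the order of the factors. *)

definition lauricella_A_term ::
  "nat \<Rightarrow> complex ^ 'r ^ 'r \<Rightarrow> (nat \<Rightarrow> complex ^ 'r ^ 'r) \<Rightarrow> (nat \<Rightarrow> complex ^ 'r ^ 'r)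
    \<Rightarrow> (nat \<Rightarrow> complex) \<Rightarrow> (nat \<Rightarrow> nat) \<Rightarrow> complex ^ 'r ^ 'r" where
  "lauricella_A_term n A B C x m =
     mat_smult ((\<Prod>i=1..n. x i ^ m i) / (\<Prod>i=1..n. fact (m i)))
       (mat_pochhammer A (\<Sum>i=1..n. m i)
        ** mat_prod_list (map (\<lambda>i. mat_pochhammer (B i) (m i)) [1..<Suc n])
        ** mat_prod_list (map (\<lambda>i. matrix_inv (mat_pochhammer (C i) (m i))) [1..<Suc n]))"

(* A multi-index (m_1, ..., m_n) of naturals is an extensional function on {1..n}. *)

definition multi_indices :: "nat \<Rightarrow> (nat \<Rightarrow> nat) set" where
  "multi_indices n = {1..n} \<rightarrow>\<^sub>E UNIV"

(* Absolute convergence of the multiple series: unordered summability of the norms.  The norm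
   on complex ^ 'r ^ 'r is the Frobenius norm; all norms give the same notion.  This is written
   out since HOL-Analysis has two constants named abs_summable_on. *)

definition lauricella_A_abs_convergent ::
  "nat \<Rightarrow> complex ^ 'r ^ 'r \<Rightarrow> (nat \<Rightarrow> complex ^ 'r ^ 'r) \<Rightarrow> (nat \<Rightarrow> complex ^ 'r ^ 'r)
    \<Rightarrow> (nat \<Rightarrow> complex) \<Rightarrow> bool" where
  "lauricella_A_abs_convergent n A B C x \<longleftrightarrow>
     (\<lambda>m. norm (lauricella_A_term n A B C x m)) summable_on multi_indices n"

end

theory Submission
  imports Defs
begin

text \<open>
  Up to a factor that grows more slowly than any geometric sequence, the norm of \<open>(M)\<^sub>k\<close> is bounded
  by \<open>k!\<close> and that of its inverse by \<open>1 / k!\<close>: passing from \<open>k\<close> to \<open>k + 1\<close> multiplies by \<open>M + k I\<close> or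
  by its inverse, whose norms are comparable with \<open>k\<close> and \<open>1 / k\<close> for large \<open>k\<close>.
  Hence for every \<open>s > 1\<close> there are
  bounds \<open>K s\<^sup>k k!\<close> and \<open>K s\<^sup>k / k!\<close> (\<open>norm_mat_pochhammer_le\<close>, \<open>norm_inv_mat_pochhammer_le\<close>).  The
  inverses of \<open>(C\<^sub>i)\<^sub>k\<close> exist because no eigenvalue of \<open>C\<^sub>i\<close> is a nonpositive integer.

  With \<open>N = m\<^sub>1 + \<dots> + m\<^sub>n\<close>, the factorials from \<open>(B\<^sub>i)\<close> and \<open>(C\<^sub>i)\<close> cancel, and the norm of the term
  of index \<open>m\<close> is at most a constant times the multinomial coefficient of \<open>m\<close> times
  \<open>\<Prod>i. y\<^sub>i ^ m\<^sub>i\<close>, where \<open>y\<^sub>i = s ^ 3 * \<bar>x\<^sub>i\<bar>\<close>.  The three powers of \<open>s\<close> come from the three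
  families of Pochhammer factors.  By the multinomial theorem this is at most \<open>t ^ N\<close> with
  \<open>t = \<Sum>i. y\<^sub>i\<close> (\<open>multinomial_term_le\<close>).  The sum of the \<open>\<bar>x\<^sub>i\<bar>\<close> is below 1, so \<open>s\<close> can be taken so
  close to 1 that \<open>t < 1\<close>; and \<open>t ^ N = \<Prod>i. t ^ m\<^sub>i\<close> is then the term of a product of \<open>n\<close> convergent
  geometric series.
\<close>

section \<open>Submultiplicativity of the Frobenius norm\<close>

lemma norm_sum_mult_le_L2_set:
  fixes f g :: "'a \<Rightarrow> 'b::real_normed_algebra"
  shows "norm (\<Sum>k\<in>S. f k * g k) \<le> L2_set (\<lambda>k. norm (f k)) S * L2_set (\<lambda>k. norm (g k)) S"
proof -
  have "norm (\<Sum>k\<in>S. f k * g k) \<le> (\<Sum>k\<in>S. \<bar>norm (f k)\<bar> * \<bar>norm (g k)\<bar>)"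
    by (rule sum_norm_le) (simp add: norm_mult_ineq)
  also have "\<dots> \<le> L2_set (\<lambda>k. norm (f k)) S * L2_set (\<lambda>k. norm (g k)) S"
    by (rule L2_set_mult_ineq)
  finally show ?thesis .
qed

lemma norm_matrix_vector_mult_le:
  fixes M :: "complex ^ 'n ^ 'm"
  shows "norm (M *v v) \<le> norm M * norm v"
proof -
  have "norm (M *v v) = L2_set (\<lambda>i. norm (\<Sum>k\<in>UNIV. M $ i $ k * v $ k)) UNIV"
    by (simp add: norm_vec_def matrix_vector_mult_def)
  also have "\<dots> \<le> L2_set (\<lambda>i. norm (M $ i) * norm v) UNIV"
    by (intro L2_set_mono)
       (use norm_sum_mult_le_L2_set in \<open>auto simp: norm_vec_def\<close>)
  also have "\<dots> = norm M * norm v"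
    by (simp add: L2_set_left_distrib norm_vec_def [of M])
  finally show ?thesis .
qed

text \<open>
  By the Cauchy--Schwarz inequality the entry \<open>(i, j)\<close> of the product is at most the norm of row
  \<open>i\<close> of \<open>X\<close> times the norm of column \<open>j\<close> of \<open>Y\<close>; the Frobenius norm of this rank-one array is the
  product of the two norms.
\<close>

lemma norm_matrix_mult_le:
  fixes X :: "complex ^ 'n ^ 'm" and Y :: "complex ^ 'p ^ 'n"
  shows "norm (X ** Y) \<le> norm X * norm Y"
proof -
  define c where "c = (\<lambda>j. L2_set (\<lambda>k. norm (Y $ k $ j)) UNIV)"
  have "norm (X ** Y) =
      L2_set (\<lambda>i. L2_set (\<lambda>j. norm (\<Sum>k\<in>UNIV. X $ i $ k * Y $ k $ j)) UNIV) UNIV"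
    by (simp add: norm_vec_def matrix_matrix_mult_def)
  also have "\<dots> \<le> L2_set (\<lambda>i. L2_set (\<lambda>j. norm (X $ i) * c j) UNIV) UNIV"
    by (intro L2_set_mono L2_set_nonneg)
       (use norm_sum_mult_le_L2_set in \<open>auto simp: norm_vec_def c_def\<close>)
  also have "\<dots> = norm X * L2_set c UNIV"
    by (simp add: L2_set_right_distrib [symmetric] L2_set_left_distrib [symmetric]
        L2_set_nonneg norm_vec_def [of X])
  also have "L2_set c UNIV = norm Y"
  proof -
    have "(\<Sum>j\<in>UNIV. (c j)\<^sup>2) = (\<Sum>j\<in>UNIV. \<Sum>k\<in>UNIV. (norm (Y $ k $ j))\<^sup>2)"
      by (simp add: c_def L2_set_def sum_nonneg)
    also have "\<dots> = (\<Sum>k\<in>UNIV. \<Sum>j\<in>UNIV. (norm (Y $ k $ j))\<^sup>2)"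
      by (rule sum.swap)
    also have "\<dots> = (\<Sum>k\<in>UNIV. (norm (Y $ k))\<^sup>2)"
      by (simp add: norm_vec_def L2_set_def sum_nonneg)
    finally show ?thesis
      by (simp add: norm_vec_def [of Y] L2_set_def)
  qed
  finally show ?thesis .
qed

lemma norm_mat_smult: "norm (mat_smult c M) = norm c * norm M"
  by (simp add: mat_smult_def norm_vec_def norm_mult L2_set_right_distrib)

lemma matrix_mult_mat: "M ** mat c = mat_smult c M"
  by (simp add: matrix_matrix_mult_def mat_def mat_smult_def vec_eq_iff if_distrib
      sum.delta cong: if_cong)

lemma mat_mult_matrix: "mat c ** M = mat_smult c M"
  by (simp add: matrix_matrix_mult_def mat_def mat_smult_def vec_eq_iff if_distrib
      if_distribR sum.delta cong: if_cong)

lemma matrix_add_mult_distrib: "(A + B) ** M = A ** M + B ** M"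
  for A B :: "'a::semiring_1 ^ 'n ^ 'm"
  by (simp add: matrix_matrix_mult_def vec_eq_iff distrib_right sum.distrib)

lemma mat_mult_vector: "mat c *v v = c *s v"
  by (simp add: matrix_vector_mult_def mat_def vec_eq_iff if_distrib
      if_distribR sum.delta cong: if_cong)

text \<open>
  The Frobenius norm of the identity is the square root of the dimension, so the identity that ends the fold leaves a
  constant factor, which does not depend on the length of the list.
\<close>

lemma norm_mat_prod_list_le:
  "norm (mat_prod_list (map F xs)) \<le> norm (mat 1 :: complex ^ 'r ^ 'r) * (\<Prod>i\<leftarrow>xs. norm (F i))"
  for F :: "'a \<Rightarrow> complex ^ 'r ^ 'r"
proof (induction xs)
  case Nil
  show ?case by (simp add: mat_prod_list_def)
next
  case (Cons i xs)
  have "norm (mat_prod_list (map F (i # xs))) \<le> norm (F i) * norm (mat_prod_list (map F xs))"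
    by (simp add: mat_prod_list_def norm_matrix_mult_le)
  also have "\<dots> \<le> norm (F i) * (norm (mat 1 :: complex ^ 'r ^ 'r) * (\<Prod>i\<leftarrow>xs. norm (F i)))"
    by (intro mult_left_mono Cons.IH) simp
  finally show ?case by (simp add: mult_ac)
qed

section \<open>The spectrum and invertibility of Pochhammer matrices\<close>

lemma poly_det:
  fixes P :: "'a::comm_ring_1 poly ^ 'n ^ 'n"
  shows "poly (det P) z = det (\<chi> i j. poly (P $ i $ j) z)"
proof -
  have "poly (of_int k) z = of_int k" for k :: int
    by (simp add: of_int_poly)
  thus ?thesis
    by (simp add: det_def poly_sum poly_prod)
qed

text \<open>
  The eigenvalues are the roots of the characteristic polynomial \<open>det (M - z I)\<close>.  This polynomial
  is nonzero because it does not vanish at \<open>\<parallel>M\<parallel> + 1\<close>, which is too large for an eigenvalue.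
  Finiteness is what makes \<^const>\<open>spec_beta\<close> a lower bound for the real parts.
\<close>

lemma finite_mat_spectrum: "finite (mat_spectrum M)"
proof -
  define P :: "complex poly ^ 'a ^ 'a" where
    "P = (\<chi> i j. [: M $ i $ j, if i = j then - 1 else 0 :])"
  have det_P: "poly (det P) z = det (M - mat z)" for z
    unfolding poly_det
    by (rule arg_cong [where f = det]) (simp add: P_def mat_def vec_eq_iff)
  have shift: "(M - mat z) *v v = M *v v - z *s v" for z v
    by (simp add: matrix_vector_mult_diff_rdistrib mat_mult_vector)
  have spectrum_iff: "z \<in> mat_spectrum M \<longleftrightarrow> poly (det P) z = 0" for z
  proof -
    have "det (M - mat z) = 0 \<longleftrightarrow> \<not> (\<forall>v. (M - mat z) *v v = 0 \<longrightarrow> v = 0)"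
      using invertible_det_nz [of "M - mat z"] invertible_left_inverse [of "M - mat z"]
        matrix_left_invertible_ker [of "M - mat z"] by blast
    thus ?thesis by (auto simp: det_P mat_spectrum_def shift)
  qed
  have "complex_of_real (norm M + 1) \<notin> mat_spectrum M"
  proof
    assume "complex_of_real (norm M + 1) \<in> mat_spectrum M"
    then obtain v where "v \<noteq> 0" and v: "M *v v = complex_of_real (norm M + 1) *s v"
      unfolding mat_spectrum_def by blast
    have "complex_of_real (norm M + 1) *s v = (norm M + 1) *\<^sub>R v"
      by (simp add: vec_eq_iff scaleR_conv_of_real [where 'a = complex]
          distrib_right)
    hence "norm (M *v v) = (norm M + 1) * norm v"
      unfolding v by simp
    with norm_matrix_vector_mult_le [of M v] \<open>v \<noteq> 0\<close> show False by (simp add: algebra_simps)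
  qed
  hence "det P \<noteq> 0"
    unfolding spectrum_iff by auto
  moreover have "mat_spectrum M = {z. poly (det P) z = 0}"
    using spectrum_iff by blast
  ultimately show ?thesis
    by (simp add: poly_roots_finite)
qed

lemma positive_stable_imp_invertible_shift:
  assumes "positive_stable M"
  shows "invertible (M + mat (of_nat k))"
proof -
  have "v = 0" if "(M + mat (of_nat k)) *v v = 0" for v
  proof (rule ccontr)
    assume "v \<noteq> 0"
    have "M *v v = (- of_nat k) *s v"
      using that
      by (simp add: matrix_vector_mult_add_rdistrib mat_mult_vector eq_neg_iff_add_eq_0 vec_eq_iff)
    with \<open>v \<noteq> 0\<close> have "- of_nat k \<in> mat_spectrum M"
      unfolding mat_spectrum_def by blast
    hence "spec_beta M \<le> Re (- of_nat k)"
      unfolding spec_beta_def by (intro Min_le finite_imageI finite_mat_spectrum imageI)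
    with assms show False by (simp add: positive_stable_def)
  qed
  thus ?thesis
    using invertible_left_inverse matrix_left_invertible_ker by blast
qed

lemma invertible_mat_pochhammer:
  assumes "positive_stable M"
  shows "invertible (mat_pochhammer M k)"
proof (induction k)
  case 0
  have "mat 1 ** mat 1 = (mat 1 :: complex ^ 'a ^ 'a)" by simp
  thus ?case unfolding mat_pochhammer.simps invertible_def by blast
next
  case (Suc k)
  thus ?case
    by (simp add: invertible_mult positive_stable_imp_invertible_shift [OF assms])
qed

section \<open>Growth of Pochhammer matrices and of their inverses\<close>

lemma eventually_ratio_le_imp_geometric_bound:
  fixes f :: "nat \<Rightarrow> real"
  assumes nonneg: "\<And>k. 0 \<le> f k" and "1 \<le> s"
    and ratio: "\<And>k. L \<le> real k \<Longrightarrow> f (Suc k) \<le> s * f k"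
  shows "\<exists>K\<ge>0. \<forall>k. f k \<le> K * s ^ k"
proof -
  define N where "N = nat \<lceil>L\<rceil>"
  define K where "K = (\<Sum>j\<le>N. f j)"
  have "K \<ge> 0" unfolding K_def by (intro sum_nonneg nonneg)
  have initial: "f k \<le> K * s ^ k" if "k \<le> N" for k
  proof -
    have "f k \<le> K"
      unfolding K_def by (rule member_le_sum) (use that nonneg in auto)
    also have "K \<le> K * s ^ k"
      using \<open>K \<ge> 0\<close> \<open>1 \<le> s\<close> by (simp add: mult_le_cancel_left1)
    finally show ?thesis .
  qed
  have "f k \<le> K * s ^ k" for k
  proof (induction k)
    case 0
    show ?case by (rule initial) simp
  next
    case (Suc k)
    show ?case
    proof (cases "Suc k \<le> N")
      case False
      hence "L \<le> real k" unfolding N_def by linarith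
      hence "f (Suc k) \<le> s * f k" by (rule ratio)
      also have "\<dots> \<le> s * (K * s ^ k)"
        using \<open>1 \<le> s\<close> by (intro mult_left_mono Suc.IH) simp
      finally show ?thesis by (simp add: mult_ac)
    qed (rule initial)
  qed
  with \<open>K \<ge> 0\<close> show ?thesis by blast
qed

text \<open>
  After division by \<open>k!\<close> the ratio of consecutive norms is at most \<open>(\<parallel>M\<parallel> + k) / (k + 1)\<close>, which tends
  to 1.
\<close>

lemma norm_mat_pochhammer_le:
  assumes "1 < s"
  shows "\<exists>K\<ge>0. \<forall>k. norm (mat_pochhammer M k) \<le> K * s ^ k * fact k"
proof -
  define f where "f k = norm (mat_pochhammer M k) / fact k" for k
  \<comment> \<open>The threshold gives \<open>\<parallel>M\<parallel> + k \<le> s (k + 1)\<close>.\<close>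
  have "f (Suc k) \<le> s * f k" if "norm M / (s - 1) \<le> real k" for k
  proof -
    let ?P = "mat_pochhammer M k"
    have "mat_pochhammer M (Suc k) = ?P ** M + mat_smult (of_nat k) ?P"
      by (simp add: matrix_add_ldistrib matrix_mult_mat)
    hence "norm (mat_pochhammer M (Suc k)) \<le> norm (?P ** M) + norm (mat_smult (of_nat k) ?P)"
      by (simp only: norm_triangle_ineq)
    also have "\<dots> \<le> norm ?P * norm M + real k * norm ?P"
      by (intro add_mono norm_matrix_mult_le) (simp add: norm_mat_smult)
    also have "\<dots> = (norm M + real k) * norm ?P"
      by (simp add: algebra_simps)
    also have "\<dots> \<le> (s * (real k + 1)) * norm ?P"
      using that \<open>1 < s\<close> by (intro mult_right_mono) (simp_all add: field_simps)
    finally have "norm (mat_pochhammer M (Suc k)) \<le> (real k + 1) * (s * norm ?P)"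
      by (simp only: mult_ac)
    hence "f (Suc k) \<le> (real k + 1) * (s * norm ?P) / fact (Suc k)"
      unfolding f_def by (intro divide_right_mono) simp_all
    also have "\<dots> = (real k + 1) * (s * norm ?P) / ((real k + 1) * fact k)"
      by (simp add: add.commute)
    also have "\<dots> = s * f k"
      by (simp add: f_def add_pos_nonneg)
    finally show ?thesis .
  qed
  hence "\<exists>K\<ge>0. \<forall>k. f k \<le> K * s ^ k"
    using assms by (intro eventually_ratio_le_imp_geometric_bound [where L = "norm M / (s - 1)"])
      (auto simp: f_def)
  thus ?thesis by (simp add: f_def field_simps)
qed

text \<open>
  The recursion \<open>(M + k I) (M)\<^bsub>k+1\<^esub>\<close> inverse \<open>= (M)\<^sub>k\<close> inverse and the reverse triangle inequality
  show that, after multiplication by \<open>k!\<close>, the ratio of consecutive norms is at most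
  \<open>(k + 1) / (k - \<parallel>M\<parallel>)\<close> for large \<open>k\<close>, which again tends to 1.
\<close>

lemma norm_inv_mat_pochhammer_le:
  assumes "positive_stable M" "1 < s"
  shows "\<exists>K\<ge>0. \<forall>k. norm (matrix_inv (mat_pochhammer M k)) \<le> K * s ^ k / fact k"
proof -
  define Q where "Q k = matrix_inv (mat_pochhammer M k)" for k
  have inverse: "mat_pochhammer M k ** Q k = mat 1" "Q k ** mat_pochhammer M k = mat 1" for k
  proof -
    have "mat_pochhammer M k ** Q k = mat 1 \<and> Q k ** mat_pochhammer M k = mat 1"
      unfolding Q_def matrix_inv_def
      by (rule someI_ex) (use invertible_mat_pochhammer [OF assms(1)] in \<open>auto simp: invertible_def\<close>)
    thus "mat_pochhammer M k ** Q k = mat 1" "Q k ** mat_pochhammer M k = mat 1" by auto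
  qed
  define f where "f k = norm (Q k) * fact k" for k
  \<comment> \<open>The threshold is the solution \<open>k\<close> of \<open>k + 1 = s (k - \<parallel>M\<parallel>)\<close>.\<close>
  have "f (Suc k) \<le> s * f k" if "(1 + s * norm M) / (s - 1) \<le> real k" for k
  proof -
    let ?D = "Q (Suc k)"
    have "Q k = Q k ** (mat_pochhammer M (Suc k) ** ?D)"
      by (simp only: inverse matrix_mul_rid)
    also have "\<dots> = (Q k ** mat_pochhammer M k) ** ((M + mat (of_nat k)) ** ?D)"
      by (simp add: matrix_mul_assoc)
    also have "\<dots> = M ** ?D + mat_smult (of_nat k) ?D"
      by (simp add: inverse matrix_add_mult_distrib mat_mult_matrix [where c = "of_nat k"])
    finally have "mat_smult (of_nat k) ?D = Q k - M ** ?D" by simp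
    hence "real k * norm ?D = norm (Q k - M ** ?D)"
      by (metis norm_mat_smult norm_of_nat)
    also have "\<dots> \<le> norm (Q k) + norm M * norm ?D"
      using norm_triangle_ineq4 [of "Q k" "M ** ?D"] norm_matrix_mult_le [of M ?D] by linarith
    finally have step: "(real k - norm M) * norm ?D \<le> norm (Q k)"
      by (simp add: algebra_simps)
    have "(real k + 1) * norm ?D \<le> (s * (real k - norm M)) * norm ?D"
      using that \<open>1 < s\<close> by (intro mult_right_mono) (simp_all add: field_simps)
    also have "\<dots> \<le> s * norm (Q k)"
      using step \<open>1 < s\<close> by (simp add: mult.assoc)
    finally have "((real k + 1) * norm ?D) * fact k \<le> (s * norm (Q k)) * fact k"
      by (intro mult_right_mono) simp_all
    thus ?thesis by (simp add: f_def algebra_simps)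
  qed
  hence "\<exists>K\<ge>0. \<forall>k. f k \<le> K * s ^ k"
    using assms by (intro eventually_ratio_le_imp_geometric_bound
        [where L = "(1 + s * norm M) / (s - 1)"]) (auto simp: f_def)
  thus ?thesis by (simp add: f_def Q_def field_simps)
qed

section \<open>The dominating series\<close>

text \<open>
  A single term of the multinomial expansion of a power of \<open>\<Sum>i. y\<^sub>i\<close> is at most the whole power.
  The induction on the index set merges all indices but one and bounds a single term of the
  binomial expansion.  The inequality is multiplied out to avoid quotients of factorials.
\<close>

lemma multinomial_term_le:
  fixes y :: "'a \<Rightarrow> real"
  assumes "finite I" "\<And>i. i \<in> I \<Longrightarrow> 0 \<le> y i"
  shows "fact (\<Sum>i\<in>I. m i) * (\<Prod>i\<in>I. y i ^ m i)
    \<le> (\<Prod>i\<in>I. fact (m i)) * (\<Sum>i\<in>I. y i) ^ (\<Sum>i\<in>I. m i)"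
  using assms
proof (induction I rule: finite_induct)
  case empty
  show ?case by simp
next
  case (insert j I)
  define k where "k = m j"
  define N where "N = (\<Sum>i\<in>I. m i)"
  define Y where "Y = (\<Sum>i\<in>I. y i)"
  have "0 \<le> y j" "0 \<le> Y"
    using insert.prems by (auto simp: Y_def intro: sum_nonneg)
  have "real ((k + N) choose k) * y j ^ k * Y ^ N \<le> (y j + Y) ^ (k + N)"
  proof -
    have "real ((k + N) choose k) * y j ^ k * Y ^ (k + N - k)
        \<le> (\<Sum>l\<le>k + N. real ((k + N) choose l) * y j ^ l * Y ^ (k + N - l))"
      by (rule member_le_sum) (use \<open>0 \<le> y j\<close> \<open>0 \<le> Y\<close> in auto)
    thus ?thesis by (simp add: binomial_ring)
  qed
  moreover have "fact (k + N) = fact k * fact N * real ((k + N) choose k)"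
    using binomial_fact_lemma [of k "k + N"] by (metis add_diff_cancel_left' le_add1 of_nat_fact of_nat_mult)
  ultimately have binomial: "fact (k + N) * (y j ^ k * Y ^ N) \<le> fact k * fact N * (y j + Y) ^ (k + N)"
    by (simp add: mult.assoc mult_left_mono)
  have IH: "fact N * (\<Prod>i\<in>I. y i ^ m i) \<le> (\<Prod>i\<in>I. fact (m i)) * Y ^ N"
    unfolding N_def Y_def using insert by simp
  \<comment> \<open>The claim is multiplied by \<open>fact N\<close>, so that the induction hypothesis applies to the product
    over \<open>I\<close> and the binomial bound to the rest.\<close>
  have "fact N * (fact (k + N) * (y j ^ k * (\<Prod>i\<in>I. y i ^ m i)))
      = (fact (k + N) * y j ^ k) * (fact N * (\<Prod>i\<in>I. y i ^ m i))"
    by (simp add: mult_ac)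
  also have "\<dots> \<le> (fact (k + N) * y j ^ k) * ((\<Prod>i\<in>I. fact (m i)) * Y ^ N)"
    by (intro mult_left_mono IH) (simp add: \<open>0 \<le> y j\<close>)
  also have "\<dots> = (\<Prod>i\<in>I. fact (m i)) * (fact (k + N) * (y j ^ k * Y ^ N))"
    by (simp add: mult_ac)
  also have "\<dots> \<le> (\<Prod>i\<in>I. fact (m i)) * (fact k * fact N * (y j + Y) ^ (k + N))"
    by (intro mult_left_mono binomial prod_nonneg) simp
  also have "\<dots> = fact N * (fact k * (\<Prod>i\<in>I. fact (m i)) * (y j + Y) ^ (k + N))"
    by (simp add: mult_ac)
  finally show ?case
    using insert.hyps by (simp add: k_def N_def Y_def)
qed

text \<open>The family is the product of the geometric series in the single indices.\<close>

lemma summable_on_PiE_power: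
  fixes t :: real
  assumes "finite I" "0 \<le> t" "t < 1"
  shows "(\<lambda>m. t ^ (\<Sum>i\<in>I. m i)) summable_on (I \<rightarrow>\<^sub>E UNIV)"
proof -
  have "(\<lambda>k. norm (t ^ k)) summable_on (UNIV :: nat set)"
    using assms by (intro summable_on_UNIV_nonneg_real_iff [THEN iffD2]) (auto intro!: summable_geometric)
  hence "Infinite_Set_Sum.abs_summable_on (\<lambda>k. t ^ k) (UNIV :: nat set)"
    by (rule abs_summable_equivalent [THEN iffD1])
  hence "Infinite_Set_Sum.abs_summable_on (\<lambda>m. \<Prod>i\<in>I. t ^ m i) (I \<rightarrow>\<^sub>E UNIV)"
    using assms(1) by (intro Infinite_Set_Sum.abs_summable_on_prod_PiE) auto
  hence "(\<lambda>m. norm (\<Prod>i\<in>I. t ^ m i)) summable_on (I \<rightarrow>\<^sub>E UNIV)"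
    by (simp only: abs_summable_equivalent)
  thus ?thesis
    using assms(2) by (simp add: power_sum abs_prod)
qed

lemma power_scale_below_one:
  fixes \<rho> :: real
  assumes "0 \<le> \<rho>" "\<rho> < 1"
  obtains s where "1 < s" "s ^ 3 * \<rho> < 1"
proof
  \<comment> \<open>Any number strictly between 1 and \<open>1 / \<rho>\<close> would do; this one is also defined for \<open>\<rho> = 0\<close>.\<close>
  define \<sigma> where "\<sigma> = 2 / (1 + \<rho>)"
  have "1 < \<sigma>" "\<sigma> * \<rho> < 1"
    using assms by (simp_all add: \<sigma>_def field_simps)
  thus "1 < root 3 \<sigma>" "root 3 \<sigma> ^ 3 * \<rho> < 1" by simp_all
qed

section \<open>Absolute convergence\<close>

theorem theorem3p5:
  fixes n :: nat
    and A :: "complex ^ 'r ^ 'r"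
    and B C :: "nat \<Rightarrow> complex ^ 'r ^ 'r"
    and x :: "nat \<Rightarrow> complex"
  assumes "n \<ge> 1"
    and "positive_stable A"
    and "\<And>i. i \<in> {1..n} \<Longrightarrow> positive_stable (B i)"
    and "\<And>i. i \<in> {1..n} \<Longrightarrow> positive_stable (C i)"
    and "spec_alpha A < 1"
    and "\<And>i. i \<in> {1..n} \<Longrightarrow> spec_alpha (B i) < spec_beta (C i)"
    and "(\<Sum>i=1..n. norm (x i)) < 1"
  shows "lauricella_A_abs_convergent n A B C x"
proof -
  obtain s where s: "1 < s" "s ^ 3 * (\<Sum>i=1..n. norm (x i)) < 1"
    using power_scale_below_one [OF sum_nonneg assms(7)] by (metis norm_ge_zero)
  define y where "y i = s ^ 3 * norm (x i)" for i
  define t where "t = (\<Sum>i=1..n. y i)"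
  have "0 \<le> y i" for i using s by (simp add: y_def)
  hence "0 \<le> t" by (simp add: t_def sum_nonneg)
  have "t < 1" using s by (simp add: t_def y_def sum_distrib_left)

  obtain a where a: "a \<ge> 0" "\<And>k. norm (mat_pochhammer A k) \<le> a * s ^ k * fact k"
    using norm_mat_pochhammer_le [OF s(1)] by blast
  have "\<forall>i. \<exists>K\<ge>0. \<forall>k. norm (mat_pochhammer (B i) k) \<le> K * s ^ k * fact k"
    using norm_mat_pochhammer_le [OF s(1)] by blast
  then obtain b where b: "\<And>i. b i \<ge> 0"
      "\<And>i k. norm (mat_pochhammer (B i) k) \<le> b i * s ^ k * fact k"
    by metis
  have "\<forall>i\<in>{1..n}. \<exists>K\<ge>0. \<forall>k. norm (matrix_inv (mat_pochhammer (C i) k)) \<le> K * s ^ k / fact k"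
    using norm_inv_mat_pochhammer_le [OF assms(4) s(1)] by blast
  then obtain c where c: "\<And>i. i \<in> {1..n} \<Longrightarrow> c i \<ge> 0"
      "\<And>i k. i \<in> {1..n} \<Longrightarrow> norm (matrix_inv (mat_pochhammer (C i) k)) \<le> c i * s ^ k / fact k"
    by metis

  define \<kappa> where "\<kappa> = norm (mat 1 :: complex ^ 'r ^ 'r)"
  define K where "K = a * (\<kappa> * (\<Prod>i=1..n. b i)) * (\<kappa> * (\<Prod>i=1..n. c i))"
  have "\<kappa> \<ge> 0" by (simp add: \<kappa>_def)
  have "K \<ge> 0"
    unfolding K_def using a b c \<open>\<kappa> \<ge> 0\<close> by (intro mult_nonneg_nonneg prod_nonneg) auto
  have list: "(\<Prod>i\<leftarrow>[1..<Suc n]. f i) = (\<Prod>i=1..n. f i)" for f :: "nat \<Rightarrow> real"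
    by (subst prod.distinct_set_conv_list [symmetric]) (simp_all add: atLeastLessThanSuc_atLeastAtMost del: upt_Suc)

  have bound: "norm (lauricella_A_term n A B C x m) \<le> K * t ^ (\<Sum>i=1..n. m i)" for m
  proof -
    define N where "N = (\<Sum>i=1..n. m i)"
    define F where "F = (\<Prod>i=1..n. fact (m i) :: real)"
    have "F > 0" by (simp add: F_def prod_pos)
    have s_N: "(\<Prod>i=1..n. s ^ m i) = s ^ N"
      by (simp add: N_def power_sum)
    let ?MB = "mat_prod_list (map (\<lambda>i. mat_pochhammer (B i) (m i)) [1..<Suc n])"
    let ?MC = "mat_prod_list (map (\<lambda>i. matrix_inv (mat_pochhammer (C i) (m i))) [1..<Suc n])"
    have "norm ?MB \<le> \<kappa> * (\<Prod>i=1..n. norm (mat_pochhammer (B i) (m i)))"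
      unfolding \<kappa>_def list [symmetric] by (rule norm_mat_prod_list_le)
    also have "\<dots> \<le> \<kappa> * (\<Prod>i=1..n. b i * s ^ m i * fact (m i))"
      using \<open>\<kappa> \<ge> 0\<close> b by (intro mult_left_mono prod_mono) auto
    finally have MB: "norm ?MB \<le> \<kappa> * (\<Prod>i=1..n. b i) * (s ^ N * F)"
      by (simp only: prod.distrib s_N F_def mult_ac)
    have "norm ?MC \<le> \<kappa> * (\<Prod>i=1..n. norm (matrix_inv (mat_pochhammer (C i) (m i))))"
      unfolding \<kappa>_def list [symmetric] by (rule norm_mat_prod_list_le)
    also have "\<dots> \<le> \<kappa> * (\<Prod>i=1..n. c i * s ^ m i / fact (m i))"
      using \<open>\<kappa> \<ge> 0\<close> c by (intro mult_left_mono prod_mono) auto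
    finally have MC: "norm ?MC \<le> \<kappa> * (\<Prod>i=1..n. c i) * (s ^ N / F)"
      by (simp only: prod.distrib prod_dividef s_N F_def mult_ac times_divide_eq_right)
    have "norm (mat_pochhammer A N ** ?MB ** ?MC) \<le> norm (mat_pochhammer A N) * norm ?MB * norm ?MC"
      by (meson norm_matrix_mult_le mult_right_mono norm_ge_zero order_trans)
    also have "\<dots> \<le> (a * s ^ N * fact N) * (\<kappa> * (\<Prod>i=1..n. b i) * (s ^ N * F))
        * (\<kappa> * (\<Prod>i=1..n. c i) * (s ^ N / F))"
      using a(1) b(1) s(1) \<open>\<kappa> \<ge> 0\<close> \<open>F > 0\<close>
      by (intro mult_mono a(2) MB MC mult_nonneg_nonneg prod_nonneg) auto
    also have "\<dots> = K * (s ^ 3) ^ N * fact N"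
      using \<open>F > 0\<close> by (simp add: K_def power_mult [symmetric] power3_eq_cube power_mult_distrib field_simps)
    finally have matrices: "norm (mat_pochhammer A N ** ?MB ** ?MC) \<le> K * (s ^ 3) ^ N * fact N" .
    have "norm (lauricella_A_term n A B C x m)
        = (\<Prod>i=1..n. norm (x i) ^ m i) / F * norm (mat_pochhammer A N ** ?MB ** ?MC)"
      by (simp add: lauricella_A_term_def norm_mat_smult norm_divide prod_norm [symmetric]
          norm_power F_def N_def del: upt_Suc)
    also have "\<dots> \<le> (\<Prod>i=1..n. norm (x i) ^ m i) / F * (K * (s ^ 3) ^ N * fact N)"
      using \<open>F > 0\<close> by (intro mult_left_mono matrices divide_nonneg_pos prod_nonneg) auto
    also have "\<dots> = K * (fact N * (\<Prod>i=1..n. y i ^ m i)) / F"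
    proof -
      have "(\<Prod>i=1..n. y i ^ m i) = (s ^ 3) ^ N * (\<Prod>i=1..n. norm (x i) ^ m i)"
        unfolding y_def power_mult_distrib prod.distrib N_def power_sum ..
      thus ?thesis by (simp add: mult_ac)
    qed
    also have "\<dots> \<le> K * (F * t ^ N) / F"
      unfolding N_def t_def F_def
      using \<open>K \<ge> 0\<close> \<open>\<And>i. 0 \<le> y i\<close>
      by (intro divide_right_mono mult_left_mono multinomial_term_le prod_nonneg) auto
    also have "\<dots> = K * t ^ N" using \<open>F > 0\<close> by simp
    finally show ?thesis by (simp only: N_def)
  qed

  have "(\<lambda>m. K * t ^ (\<Sum>i=1..n. m i)) summable_on multi_indices n"
    unfolding multi_indices_def
    by (intro summable_on_cmult_right summable_on_PiE_power) (use \<open>0 \<le> t\<close> \<open>t < 1\<close> in auto)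
  thus ?thesis
    unfolding lauricella_A_abs_convergent_def
    by (rule summable_on_comparison_test) (use bound in auto)
qed

end
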